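(* Let $L,m\ge1$ be integers, $p=2^Lm$, and let $\mathcal{A},\mathcal{B}\in\mathbb{R}^{n\times n\times p}$. Then: (1) $\mathrm{Tr}(\mathcal{A})=\mathrm{Tr}(\mathcal{A}^\top)$; (2) $\mathrm{Tr}(\alpha\mathcal{A}+\beta\mathcal{B})=\alpha\,\mathrm{Tr}(\mathcal{A})+\beta\,\mathrm{Tr}(\mathcal{B})$ for all $\alpha,\beta\in\mathbb{R}$; (3) $\mathrm{Tr}(\mathcal{A}\star_w\mathcal{B})=\mathrm{Tr}(\mathcal{B}\star_w\mathcal{A})$; (4) $\mathrm{Tr}(\mathcal{A}^\top\star_w\mathcal{B})=\mathrm{Tr}(\mathcal{A}\star_w\mathcal{B}^\top)$; (5) $\mathrm{Tr}(\mathcal{A}^\dagger\star_w\mathcal{B}\star_w\mathcal{A})=\mathrm{Tr}(\mathcal{B})$ if either $\mathcal{A}\star_w\mathcal{A}^\dagger\star_w\mathcal{B}=\mathcal{B}$ or $\mathcal{B}\star_w\mathcal{A}\star_w\mathcal{A}^\dagger=\mathcal{B}$.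
   Context: For a real third-order tensor $\mathcal{A}\in\mathbb{R}^{n_1\times n_2\times p}$ with $p=2^Lm$, $L,m\ge1$ integers, $\mathcal{A}[:,:,k]$ denotes its $k$-th frontal slice. Wavelet transform (lazy wavelet, along the third dimension): put $\mathcal{A}_{s_0}=\mathcal{A}$ and, for $j=1,\dots,L$ and $k=1,\dots,p/2^j$, $$\mathcal{A}_{d_j}[:,:,k]=\mathcal{A}_{s_{j-1}}[:,:,2k-1]-\mathcal{A}_{s_{j-1}}[:,:,2k],\qquad \mathcal{A}_{s_j}[:,:,k]=\mathcal{A}_{s_{j-1}}[:,:,2k]+\tfrac12\mathcal{A}_{d_j}[:,:,k].$$ Then $W_{[L]}(\mathcal{A})=(\mathcal{A}_{s_L},\mathcal{A}_{d_L},\dots,\mathcal{A}_{d_1})$; here $\mathcal{A}_{s_L}$ has $m$ frontal slices and $\mathcal{A}_{d_j}$ has $p/2^j$. The map $W_{[L]}$ is invertible, with inverse $W_{[L]}^{-1}$ computed for $j=L,\dots,1$ by $\mathcal{A}_{s_{j-1}}[:,:,2k]=\mathcal{A}_{s_j}[:,:,k]-\tfrac12\mathcal{A}_{d_j}[:,:,k]$ and $\mathcal{A}_{s_{j-1}}[:,:,2k-1]=\mathcal{A}_{d_j}[:,:,k]+\mathcal{A}_{s_{j-1}}[:,:,2k]$. The $w$-product of $\mathcal{A}\in\mathbb{R}^{n_1\times n_2\times p}$ and $\mathcal{B}\in\mathbb{R}^{n_2\times n_3\times p}$ is $\mathcal{A}\star_w\mathcal{B}=W_{[L]}^{-1}(W_{[L]}(\mathcal{A})\,\Delta\,W_{[L]}(\mathcal{B}))\in\mathbb{R}^{n_1\times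 n_3\times p}$, where the face-product $\Delta$ multiplies corresponding frontal slices of corresponding components as matrices. The transpose is $\mathcal{A}^\top[i,j,:]=\mathcal{A}[j,i,:]$. Triple products are unambiguous since $\star_w$ is associative. The Moore-Penrose inverse $\mathcal{A}^\dagger$ of $\mathcal{A}\in\mathbb{R}^{n\times n\times p}$ is the (existing and unique) tensor $\mathcal{X}\in\mathbb{R}^{n\times n\times p}$ with $\mathcal{A}\star_w\mathcal{X}\star_w\mathcal{A}=\mathcal{A}$, $\mathcal{X}\star_w\mathcal{A}\star_w\mathcal{X}=\mathcal{X}$, $(\mathcal{A}\star_w\mathcal{X})^\top=\mathcal{A}\star_w\mathcal{X}$, $(\mathcal{X}\star_w\mathcal{A})^\top=\mathcal{X}\star_w\mathcal{A}$. The trace of $\mathcal{A}\in\mathbb{R}^{n\times n\times p}$ is $\mathrm{Tr}(\mathcal{A})=\sum_{k=1}^p\sum_{i=1}^n\mathcal{A}[i,i,k]$. *)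

theory Defs
  imports "HOL-Analysis.Determinants"
begin

text \<open>
  A tensor with \<open>p\<close> frontal slices is the list of these slices, of length \<open>p\<close>; the dimensions
  of the slices are types, the number of slices is not. The mathematics numbers slices from 1,
  lists from 0; only \<open>slice\<close> and \<open>tensor_of\<close> see the difference.
\<close>

type_synonym ('r, 'c) tensor = "(real^'c^'r) list"

definition tensors :: "nat \<Rightarrow> ('r::finite, 'c::finite) tensor set" where
  "tensors p = {A. length A = p}"

definition slice :: "('r::finite, 'c::finite) tensor \<Rightarrow> nat \<Rightarrow> real^'c^'r" where
  "slice A k = A ! (k - 1)"

definition tensor_of :: "nat \<Rightarrow> (nat \<Rightarrow> real^'c^'r) \<Rightarrow> ('r::finite, 'c::finite) tensor" where
  "tensor_of p f = map f [1..<p + 1]"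

definition tadd :: "('r::finite, 'c::finite) tensor \<Rightarrow> ('r, 'c) tensor \<Rightarrow> ('r, 'c) tensor" where
  "tadd A B = map2 (+) A B"

definition tscale :: "real \<Rightarrow> ('r::finite, 'c::finite) tensor \<Rightarrow> ('r, 'c) tensor" where
  "tscale \<alpha> A = map (\<lambda>M. \<alpha> *\<^sub>R M) A"

definition ttranspose :: "('r::finite, 'c::finite) tensor \<Rightarrow> ('c, 'r) tensor" where
  "ttranspose A = map Finite_Cartesian_Product.transpose A"

definition ttrace :: "('n::finite, 'n) tensor \<Rightarrow> real" where
  "ttrace A = (\<Sum>k = 1..length A. \<Sum>i\<in>UNIV. slice A k $ i $ i)"

definition wdetail :: "('r::finite, 'c::finite) tensor \<Rightarrow> ('r, 'c) tensor" where
  "wdetail S = tensor_of (length S div 2) (\<lambda>k. slice S (2 * k - 1) - slice S (2 * k))"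

definition wapprox :: "('r::finite, 'c::finite) tensor \<Rightarrow> ('r, 'c) tensor" where
  "wapprox S = tensor_of (length S div 2)
     (\<lambda>k. slice S (2 * k) + (1 / 2) *\<^sub>R slice (wdetail S) k)"

text \<open>
  The transform \<open>(A\<^sub>s\<^sub>L, A\<^sub>d\<^sub>L, \<dots>, A\<^sub>d\<^sub>1)\<close> is represented as \<open>(A\<^sub>s\<^sub>L, [A\<^sub>d\<^sub>L, \<dots>, A\<^sub>d\<^sub>1])\<close>.
\<close>

type_synonym ('r, 'c) wcoeffs = "('r, 'c) tensor \<times> ('r, 'c) tensor list"

primrec wavelet :: "nat \<Rightarrow> ('r::finite, 'c::finite) tensor \<Rightarrow> ('r, 'c) wcoeffs" where
  "wavelet 0 A = (A, [])"
| "wavelet (Suc j) A = (case wavelet j A of (S, Ds) \<Rightarrow> (wapprox S, wdetail S # Ds))"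

text \<open>One level of the inverse; \<open>k\<close> satisfies \<open>i = 2 * k\<close> or \<open>i = 2 * k - 1\<close>.\<close>

definition wmerge ::
  "('r::finite, 'c::finite) tensor \<Rightarrow> ('r, 'c) tensor \<Rightarrow> ('r, 'c) tensor" where
  "wmerge S D = tensor_of (2 * length S)
     (\<lambda>i. let k = (i + 1) div 2; E = slice S k - (1 / 2) *\<^sub>R slice D k
          in if even i then E else slice D k + E)"

definition wavelet_inv :: "('r::finite, 'c::finite) wcoeffs \<Rightarrow> ('r, 'c) tensor" where
  "wavelet_inv X = foldl wmerge (fst X) (snd X)"

definition slice_prod ::
  "('a::finite, 'b::finite) tensor \<Rightarrow> ('b, 'c::finite) tensor \<Rightarrow> ('a, 'c) tensor" where
  "slice_prod A B = map2 (**) A B"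

definition face_prod ::
  "('a::finite, 'b::finite) wcoeffs \<Rightarrow> ('b, 'c::finite) wcoeffs \<Rightarrow> ('a, 'c) wcoeffs" where
  "face_prod X Y = (slice_prod (fst X) (fst Y), map2 slice_prod (snd X) (snd Y))"

definition wprod ::
  "('a::finite, 'b::finite) tensor \<Rightarrow> nat \<Rightarrow> ('b, 'c::finite) tensor \<Rightarrow> ('a, 'c) tensor"
  ("(_ \<star>\<^bsub>_\<^esub> _)" [70, 0, 71] 70) where
  "A \<star>\<^bsub>L\<^esub> B = wavelet_inv (face_prod (wavelet L A) (wavelet L B))"

definition is_mp_inverse ::
  "nat \<Rightarrow> ('n::finite, 'n) tensor \<Rightarrow> ('n, 'n) tensor \<Rightarrow> bool" where
  "is_mp_inverse L A X \<longleftrightarrow>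
     X \<in> tensors (length A) \<and>
     A \<star>\<^bsub>L\<^esub> X \<star>\<^bsub>L\<^esub> A = A \<and>
     X \<star>\<^bsub>L\<^esub> A \<star>\<^bsub>L\<^esub> X = X \<and>
     ttranspose (A \<star>\<^bsub>L\<^esub> X) = A \<star>\<^bsub>L\<^esub> X \<and>
     ttranspose (X \<star>\<^bsub>L\<^esub> A) = X \<star>\<^bsub>L\<^esub> A"

definition mp_inverse :: "nat \<Rightarrow> ('n::finite, 'n) tensor \<Rightarrow> ('n, 'n) tensor" where
  "mp_inverse L A = (THE X. is_mp_inverse L A X)"

end

theory Submission imports Defs begin

text \<open>
  One merging step turns a slice \<open>S\<close> and a detail \<open>D\<close> into \<open>S + D/2\<close> and \<open>S - D/2\<close>, so it doubles
  the trace of the coarse part and the details drop out. Hence the trace of \<open>A \<star> B\<close> is \<open>2\<^sup>L\<close> times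
  that of the slice-wise product of the coarsest approximations, and everything reduces to matrix
  traces. The last claim becomes a cyclic permutation of three factors.
\<close>

lemma length_tensor_of [simp]: "length (tensor_of p f) = p"
  by (simp add: tensor_of_def)

lemma slice_tensor_of [simp]: "1 \<le> k \<Longrightarrow> k \<le> p \<Longrightarrow> slice (tensor_of p f) k = f k"
  by (auto simp: slice_def tensor_of_def simp del: upt_Suc)

lemma tensor_eqI:
  assumes "length A = length B" and "\<And>k. 1 \<le> k \<Longrightarrow> k \<le> length A \<Longrightarrow> slice A k = slice B k"
  shows "A = B"
proof (rule nth_equalityI)
  fix i assume "i < length A"
  then show "A ! i = B ! i" using assms(2)[of "Suc i"] by (simp add: slice_def)
qed (fact assms(1))

lemma length_wdetail [simp]: "length (wdetail S) = length S div 2"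
  by (simp add: wdetail_def)

lemma length_wapprox [simp]: "length (wapprox S) = length S div 2"
  by (simp add: wapprox_def)

lemma length_wmerge [simp]: "length (wmerge S D) = 2 * length S"
  by (simp add: wmerge_def)

text \<open>The lifting step \<open>y + (x - y)/2\<close> is the mean of the pair. This symmetric
  form matches the \<open>S + D/2\<close>, \<open>S - D/2\<close> shape of a merged pair.\<close>

lemma slice_wapprox:
  fixes S :: "('a::finite, 'b::finite) tensor"
  assumes "1 \<le> k" "k \<le> length S div 2"
  shows "slice (wapprox S) k = (1 / 2) *\<^sub>R (slice S (2 * k - 1) + slice S (2 * k))"
proof -
  have "y + (1 / 2) *\<^sub>R (x - y) = (1 / 2) *\<^sub>R (x + y)" for x y :: "real^'b^'a"
    by (simp add: vec_eq_iff field_simps)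
  then show ?thesis using assms by (simp add: wapprox_def wdetail_def)
qed

lemma slice_wmerge_even:
  assumes "1 \<le> k" "k \<le> length S"
  shows "slice (wmerge S D) (2 * k) = slice S k - (1 / 2) *\<^sub>R slice D k"
  using assms by (simp add: wmerge_def Let_def)

lemma slice_wmerge_odd:
  fixes S :: "('a::finite, 'b::finite) tensor"
  assumes "1 \<le> k" "k \<le> length S"
  shows "slice (wmerge S D) (2 * k - 1) = slice S k + (1 / 2) *\<^sub>R slice D k"
proof -
  \<comment> \<open>Since \<open>1 \<le> k\<close>, the subtraction on naturals does not truncate,
    and the rounding in \<open>wmerge\<close> recovers \<open>k\<close> from the odd index.\<close>
  have "odd (2 * k - 1)" "(2 * k - 1 + 1) div 2 = k" "1 \<le> 2 * k - 1" "2 * k - 1 \<le> 2 * length S"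
    using assms by auto
  moreover have "d + (s - (1 / 2) *\<^sub>R d) = s + (1 / 2) *\<^sub>R d" for s d :: "real^'b^'a"
    by (simp add: vec_eq_iff field_simps)
  ultimately show ?thesis by (simp add: wmerge_def Let_def del: One_nat_def)
qed

text \<open>
  If \<open>D\<close> is too short, both slices of a pair refer to the same junk value, which cancels.
\<close>

lemma wapprox_wmerge [simp]:
  fixes S :: "('a::finite, 'b::finite) tensor"
  shows "wapprox (wmerge S D) = S"
proof (rule tensor_eqI)
  fix k assume "1 \<le> k" "k \<le> length (wapprox (wmerge S D))"
  moreover have "(1 / 2) *\<^sub>R ((s + e) + (s - e)) = s" for s e :: "real^'b^'a"
    by (simp add: vec_eq_iff)
  ultimately show "slice (wapprox (wmerge S D)) k = slice S k"
    \<comment> \<open>The simplifier writes \<open>2 * k - 1\<close> as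
      \<open>2 * k - Suc 0\<close>, so the odd rule is put into the same form first.\<close>
    by (simp add: slice_wapprox slice_wmerge_even slice_wmerge_odd[simplified])
qed simp

text \<open>This form suits tensors built by \<open>map\<close> and \<open>map2\<close>; the indexed
  form \<open>ttrace_eq_sum\<close> suits the splitting into pairs of slices.\<close>

lemma ttrace_eq_sum_list: "ttrace A = sum_list (map trace A)"
proof -
  have "ttrace A = (\<Sum>k = 1..length A. trace (A ! (k - 1)))"
    by (simp add: ttrace_def slice_def trace_def)
  also have "\<dots> = (\<Sum>k = 0..<length A. trace (A ! k))"
    by (rule sum.reindex_bij_witness[of _ Suc "\<lambda>k. k - 1"]) auto
  also have "\<dots> = sum_list (map trace A)"
    by (simp add: sum_list_sum_nth)
  finally show ?thesis .
qed

lemma ttrace_eq_sum: "ttrace A = (\<Sum>k = 1..length A. trace (slice A k))"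
  by (simp add: ttrace_def trace_def)

lemma sum_pairs: "(\<Sum>k = 1..2 * n. f k) = (\<Sum>k = 1..n. f (2 * k - 1) + f (2 * k))"
  for f :: "nat \<Rightarrow> 'a::comm_monoid_add"
  by (induction n) (simp_all add: add.assoc)

lemma ttrace_wmerge: "ttrace (wmerge S D) = 2 * ttrace S"
  unfolding ttrace_eq_sum length_wmerge sum_pairs sum_distrib_left
  by (intro sum.cong refl)
     (simp add: slice_wmerge_even slice_wmerge_odd[simplified] trace_add trace_sub)

lemma length_snd_wavelet [simp]: "length (snd (wavelet j A)) = j"
  by (induction j) (simp_all add: case_prod_unfold)

lemma fst_wavelet: "fst (wavelet j A) = (wapprox ^^ j) A"
  by (induction j) (simp_all add: case_prod_unfold)

text \<open>Each \<open>wapprox\<close> undoes the outermost merge. \<open>S\<close> varies in the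
  induction because the first merge changes the starting tensor.\<close>

lemma funpow_wapprox_foldl_wmerge: "(wapprox ^^ length Ds) (foldl wmerge S Ds) = S"
  by (induction Ds arbitrary: S) simp_all

lemma ttrace_foldl_wmerge: "ttrace (foldl wmerge S Ds) = 2 ^ length Ds * ttrace S"
  by (induction Ds arbitrary: S) (simp_all add: ttrace_wmerge)

text \<open>The detail products are hidden behind an unspecified \<open>Ds\<close>: later arguments
  see only how many merges there are.\<close>

lemma wprod_eq_foldl:
  obtains Ds where "length Ds = L"
    and "A \<star>\<^bsub>L\<^esub> B = foldl wmerge (slice_prod ((wapprox ^^ L) A) ((wapprox ^^ L) B)) Ds"
  by (rule that[of "map2 slice_prod (snd (wavelet L A)) (snd (wavelet L B))"])
     (simp_all add: wprod_def wavelet_inv_def face_prod_def fst_wavelet)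

text \<open>Passing to the coarsest level is multiplicative, so nested products can be unfolded
  there into slice-wise products.\<close>

lemma funpow_wapprox_wprod:
  "(wapprox ^^ L) (A \<star>\<^bsub>L\<^esub> B) = slice_prod ((wapprox ^^ L) A) ((wapprox ^^ L) B)"
proof -
  obtain Ds where "length Ds = L"
    and "A \<star>\<^bsub>L\<^esub> B = foldl wmerge (slice_prod ((wapprox ^^ L) A) ((wapprox ^^ L) B)) Ds"
    by (rule wprod_eq_foldl)
  then show ?thesis using funpow_wapprox_foldl_wmerge[of Ds] by simp
qed

lemma ttrace_wprod:
  "ttrace (A \<star>\<^bsub>L\<^esub> B) = 2 ^ L * ttrace (slice_prod ((wapprox ^^ L) A) ((wapprox ^^ L) B))"
  by (rule wprod_eq_foldl[of L A B]) (simp add: ttrace_foldl_wmerge)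

lemma slice_prod_assoc: "slice_prod (slice_prod A B) C = slice_prod A (slice_prod B C)"
  by (rule nth_equalityI) (auto simp: slice_prod_def matrix_mul_assoc)

lemma ttrace_slice_prod_commute: "ttrace (slice_prod A B) = ttrace (slice_prod B A)"
proof -
  have "map trace (slice_prod A B) = map trace (slice_prod B A)"
    by (rule nth_equalityI) (auto simp: slice_prod_def intro: trace_mul_sym)
  then show ?thesis by (simp only: ttrace_eq_sum_list)
qed

lemma ttranspose_slice_prod:
  "ttranspose (slice_prod A B) = slice_prod (ttranspose B) (ttranspose A)"
  by (rule nth_equalityI) (auto simp: slice_prod_def ttranspose_def matrix_transpose_mul)

lemma ttranspose_ttranspose [simp]: "ttranspose (ttranspose A) = A"
  by (simp add: ttranspose_def comp_def)

lemma trace_transpose: "trace (Finite_Cartesian_Product.transpose M) = trace M"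
  by (simp add: trace_def transpose_def)

lemma ttrace_ttranspose [simp]: "ttrace (ttranspose A) = ttrace A"
  by (simp add: ttrace_eq_sum_list ttranspose_def comp_def trace_transpose)

lemma slice_ttranspose:
  "1 \<le> k \<Longrightarrow> k \<le> length A \<Longrightarrow>
    slice (ttranspose A) k = Finite_Cartesian_Product.transpose (slice A k)"
  by (simp add: slice_def ttranspose_def)

lemma length_ttranspose [simp]: "length (ttranspose A) = length A"
  by (simp add: ttranspose_def)

text \<open>Each slice of the approximation is a mean of two slices, and transposition is
  linear.\<close>

lemma wapprox_ttranspose: "wapprox (ttranspose A) = ttranspose (wapprox A)"
proof (rule tensor_eqI)
  fix k assume "1 \<le> k" "k \<le> length (wapprox (ttranspose A))"
  then have k: "1 \<le> k" "k \<le> length A div 2" by simp_all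
  then have "1 \<le> 2 * k - 1" "2 * k - 1 \<le> length A" "1 \<le> 2 * k" "2 * k \<le> length A" by linarith+
  with k show "slice (wapprox (ttranspose A)) k = slice (ttranspose (wapprox A)) k"
    by (simp add: slice_wapprox slice_ttranspose del: One_nat_def)
       (simp add: vec_eq_iff transpose_def)
qed simp

lemma funpow_wapprox_ttranspose:
  "(wapprox ^^ j) (ttranspose A) = ttranspose ((wapprox ^^ j) A)"
  by (induction j) (simp_all add: wapprox_ttranspose)

lemma ttrace_wprod_commute: "ttrace (A \<star>\<^bsub>L\<^esub> B) = ttrace (B \<star>\<^bsub>L\<^esub> A)"
  unfolding ttrace_wprod by (subst ttrace_slice_prod_commute) (rule refl)

lemma ttrace_wprod_rotate: "ttrace (A \<star>\<^bsub>L\<^esub> B \<star>\<^bsub>L\<^esub> C) = ttrace (B \<star>\<^bsub>L\<^esub> C \<star>\<^bsub>L\<^esub> A)"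
  unfolding ttrace_wprod funpow_wapprox_wprod slice_prod_assoc
  \<comment> \<open>Bracketed as \<open>A (B C)\<close>, the product has two outer factors; swapping
    them under the trace gives \<open>(B C) A\<close>.\<close>
  by (subst ttrace_slice_prod_commute) (simp only: slice_prod_assoc)

lemma ttrace_wprod_ttranspose:
  fixes A B :: "('b::finite, 'a::finite) tensor"
  shows "ttrace (ttranspose A \<star>\<^bsub>L\<^esub> B) = ttrace (A \<star>\<^bsub>L\<^esub> ttranspose B)"
proof -
  have "ttrace (slice_prod (ttranspose S) T) = ttrace (slice_prod S (ttranspose T))"
    for S T :: "('b, 'a) tensor"
    \<comment> \<open>Transposing under the trace turns the product of \<open>ttranspose S\<close>
      and \<open>T\<close> into that of \<open>ttranspose T\<close> and \<open>S\<close>; swapping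
      the factors finishes.\<close>
    using ttrace_ttranspose[of "slice_prod (ttranspose S) T"]
    by (simp add: ttranspose_slice_prod ttrace_slice_prod_commute[of S])
  then show ?thesis by (simp add: ttrace_wprod funpow_wapprox_ttranspose)
qed

lemma trace_scaleR: "trace (c *\<^sub>R M) = c * trace M" for M :: "real^'n^'n"
  by (simp add: trace_def sum_distrib_left)

lemma ttrace_linear:
  assumes "length A = length B"
  shows "ttrace (tadd (tscale \<alpha> A) (tscale \<beta> B)) = \<alpha> * ttrace A + \<beta> * ttrace B"
  using assms unfolding ttrace_eq_sum_list tadd_def tscale_def
  by (induction A B rule: list_induct2) (simp_all add: trace_add trace_scaleR algebra_simps)

theorem lemma2p5:
  fixes L m p :: nat and A B :: "('n::finite, 'n) tensor"
  assumes "L \<ge> 1" and "m \<ge> 1" and "p = 2 ^ L * m"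
    and "A \<in> tensors p" and "B \<in> tensors p"
  shows "ttrace A = ttrace (ttranspose A)
    \<and> (\<forall>\<alpha> \<beta>. ttrace (tadd (tscale \<alpha> A) (tscale \<beta> B)) = \<alpha> * ttrace A + \<beta> * ttrace B)
    \<and> ttrace (A \<star>\<^bsub>L\<^esub> B) = ttrace (B \<star>\<^bsub>L\<^esub> A)
    \<and> ttrace (ttranspose A \<star>\<^bsub>L\<^esub> B) = ttrace (A \<star>\<^bsub>L\<^esub> ttranspose B)
    \<and> (A \<star>\<^bsub>L\<^esub> mp_inverse L A \<star>\<^bsub>L\<^esub> B = B \<or> B \<star>\<^bsub>L\<^esub> A \<star>\<^bsub>L\<^esub> mp_inverse L A = B
        \<longrightarrow> ttrace (mp_inverse L A \<star>\<^bsub>L\<^esub> B \<star>\<^bsub>L\<^esub> A) = ttrace B)"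
proof (intro conjI allI impI)
  show "ttrace (tadd (tscale \<alpha> A) (tscale \<beta> B)) = \<alpha> * ttrace A + \<beta> * ttrace B" for \<alpha> \<beta>
    using assms(4,5) by (intro ttrace_linear) (simp add: tensors_def)
  show "ttrace (mp_inverse L A \<star>\<^bsub>L\<^esub> B \<star>\<^bsub>L\<^esub> A) = ttrace B"
    if "A \<star>\<^bsub>L\<^esub> mp_inverse L A \<star>\<^bsub>L\<^esub> B = B \<or> B \<star>\<^bsub>L\<^esub> A \<star>\<^bsub>L\<^esub> mp_inverse L A = B"
    \<comment> \<open>With \<open>X\<close> for the inverse, one rotation takes \<open>A X B\<close>
      to \<open>X B A\<close> and a second takes \<open>X B A\<close> to \<open>B A X\<close>;
      either hypothesis replaces one end of this chain by \<open>B\<close>.\<close>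
    using that ttrace_wprod_rotate[of A L "mp_inverse L A" B]
      ttrace_wprod_rotate[of "mp_inverse L A" L B A] by auto
qed (simp, rule ttrace_wprod_commute, rule ttrace_wprod_ttranspose)

end
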